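(* Let $h_1,\dots,h_K\in L^2(\mathcal S;\mathbb C)$ be nonzero, let $P>0$ and $\sigma^2>0$. For each $k\in\{1,\dots,K\}$ let $w_{\mathrm{MMSE},k}$ be the $k$-th entry of $$\mathbf h(\mathbf s)\left(\mathbf I_K+\frac{P}{K\sigma^2}\mathbf Q\right)^{-1},$$ rescaled by a positive constant so that $\int_{\mathcal S}|w_{\mathrm{MMSE},k}(\mathbf s)|^2\,d\mathbf s=\frac PK$. Then, for every $k$, $w_{\mathrm{MMSE},k}$ maximizes the signal-to-leakage-plus-noise ratio of user $k$ under equal power allocation, i.e. $$w_{\mathrm{MMSE},k}\in\operatorname*{arg\,max}_{w_k\in L^2(\mathcal S;\mathbb C):\ \int_{\mathcal S}|w_k(\mathbf s)|^2d\mathbf s=\frac PK}\ \mathrm{SLNR}_k(w_k),$$ where $$\mathrm{SLNR}_k(w_k)=\frac{\left|\int_{\mathcal S}h_k^*(\mathbf s)w_k(\mathbf s)\,d\mathbf s\right|^2}{\sum_{i\ne k}\left|\int_{\mathcal S}h_i^*(\mathbf s)w_k(\mathbf s)\,d\mathbf s\right|^2+\sigma^2}.$$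
   Context: $\mathcal S$ is a bounded radiating surface with surface measure $d\mathbf s$; $h_k:\mathcal S\to\mathbb C$ is the channel response of user $k$, and $\mathbf h(\mathbf s)=[h_1(\mathbf s),\dots,h_K(\mathbf s)]\in\mathbb C^{1\times K}$. The channel correlation matrix $\mathbf Q\in\mathbb C^{K\times K}$ has entries $[\mathbf Q]_{k,i}=\int_{\mathcal S}h_i(\mathbf s)h_k^*(\mathbf s)\,d\mathbf s$; $^*$ is complex conjugation and $\mathbf I_K$ the $K\times K$ identity. (The MMSE design is $\mathbf w_{\mathrm{MMSE}}(\mathbf s)=\mathbf h(\mathbf s)(\mathbf I_K+\frac{P}{K\sigma^2}\mathbf Q)^{-1}\mathbf P^{1/2}$ with a diagonal power allocation matrix $\mathbf P$; here the diagonal factor is fixed by the normalization of each entry to power $P/K$.) *)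

theory Defs
  imports "HOL-Analysis.Analysis"
begin

text \<open>
  A radiating surface is given by its surface measure \<open>M\<close>: \<open>space M\<close> is the surface and
  \<open>LINT s|M. f s\<close> is the surface integral of \<open>f\<close> over it. Elements of \<open>L\<^sup>2\<close> are represented by
  functions, so being nonzero in \<open>L\<^sup>2\<close> means not vanishing almost everywhere. The users form
  a finite type \<open>'k\<close>, and \<open>K = CARD('k)\<close>.
\<close>

definition L2 :: "'a measure \<Rightarrow> ('a \<Rightarrow> complex) set" where
  "L2 M = {f \<in> borel_measurable M. integrable M (\<lambda>s. (cmod (f s))\<^sup>2)}"

definition power_of :: "'a measure \<Rightarrow> ('a \<Rightarrow> complex) \<Rightarrow> real" where
  "power_of M w = (LINT s|M. (cmod (w s))\<^sup>2)"

definition corr_matrix :: "'a measure \<Rightarrow> ('k::finite \<Rightarrow> 'a \<Rightarrow> complex) \<Rightarrow> complex ^ 'k ^ 'k" where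
  "corr_matrix M h = (\<chi> k i. LINT s|M. h i s * cnj (h k s))"

text \<open>The entries of the row vector \<open>h(s) (I + P / (K \<sigma>\<^sup>2) Q)\<^sup>-\<^sup>1\<close>; the argument \<open>N\<close> is the
  noise power \<open>\<sigma>\<^sup>2\<close>.\<close>

definition mmse_dir ::
    "'a measure \<Rightarrow> ('k::finite \<Rightarrow> 'a \<Rightarrow> complex) \<Rightarrow> real \<Rightarrow> real \<Rightarrow> 'k \<Rightarrow> 'a \<Rightarrow> complex" where
  "mmse_dir M h P N k s =
     ((\<chi> i. h i s) v* matrix_inv (mat 1 + (P / (real CARD('k) * N)) *\<^sub>R corr_matrix M h)) $ k"

definition scale_to_power :: "'a measure \<Rightarrow> real \<Rightarrow> ('a \<Rightarrow> complex) \<Rightarrow> 'a \<Rightarrow> complex" where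
  "scale_to_power M p f s = complex_of_real (sqrt (p / power_of M f)) * f s"

text \<open>The factor in \<open>scale_to_power\<close> is the only positive constant that achieves power \<open>p\<close>.\<close>

lemma power_of_scale:
  "power_of M (\<lambda>s. complex_of_real c * f s) = c\<^sup>2 * power_of M f"
  by (simp add: power_of_def norm_mult power_mult_distrib)

lemma scale_to_power_unique:
  assumes "p > 0" and "c > 0"
    and "power_of M (\<lambda>s. complex_of_real c * f s) = p"
  shows "scale_to_power M p f = (\<lambda>s. complex_of_real c * f s)"
proof -
  have p: "c\<^sup>2 * power_of M f = p"
    using assms(3) by (simp add: power_of_scale)
  with assms have "power_of M f \<noteq> 0" by auto
  with p have "p / power_of M f = c\<^sup>2" by (auto simp: field_simps)
  with assms have "sqrt (p / power_of M f) = c" by simp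
  then show ?thesis by (simp add: scale_to_power_def fun_eq_iff)
qed

definition w_MMSE ::
    "'a measure \<Rightarrow> ('k::finite \<Rightarrow> 'a \<Rightarrow> complex) \<Rightarrow> real \<Rightarrow> real \<Rightarrow> 'k \<Rightarrow> 'a \<Rightarrow> complex" where
  "w_MMSE M h P N k = scale_to_power M (P / real CARD('k)) (mmse_dir M h P N k)"

definition SLNR ::
    "'a measure \<Rightarrow> ('k::finite \<Rightarrow> 'a \<Rightarrow> complex) \<Rightarrow> real \<Rightarrow> 'k \<Rightarrow> ('a \<Rightarrow> complex) \<Rightarrow> real" where
  "SLNR M h N k w =
     (cmod (LINT s|M. cnj (h k s) * w s))\<^sup>2 /
     ((\<Sum>i\<in>UNIV - {k}. (cmod (LINT s|M. cnj (h i s) * w s))\<^sup>2) + N)"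

end

theory Submission
  imports Defs
begin

text \<open>
  With \<open>c = K \<sigma>\<^sup>2 / P\<close>, consider the positive semidefinite form
  \<open>T(f, g) = (\<Sum>j. \<langle>f, h\<^sub>j\<rangle> \<langle>h\<^sub>j, g\<rangle>) + c \<langle>f, g\<rangle>\<close>. The MMSE direction \<open>d\<^sub>k\<close> represents the
  signal functional: \<open>T(d\<^sub>k, w) = c \<langle>h\<^sub>k, w\<rangle>\<close>. On the sphere of power \<open>P / K\<close> the value
  \<open>T(w, w)\<close> is signal plus leakage plus noise, so the SLNR is an increasing function of
  \<open>\<bar>\<langle>h\<^sub>k, w\<rangle>\<bar>\<^sup>2 / T(w, w)\<close>, which Cauchy-Schwarz for \<open>T\<close> maximizes at multiples of \<open>d\<^sub>k\<close>.
\<close>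

section \<open>The inner product on square-integrable functions\<close>

definition l2_inner :: "'a measure \<Rightarrow> ('a \<Rightarrow> complex) \<Rightarrow> ('a \<Rightarrow> complex) \<Rightarrow> complex" where
  "l2_inner M f g = (LINT s|M. cnj (f s) * g s)"

text \<open>The product is dominated pointwise by the sum of the squared moduli. This is what makes
  \<open>l2_inner\<close> additive, since the integral of a non-integrable function is 0 by
  convention.\<close>

lemma L2_prod_integrable:
  assumes "f \<in> L2 M" and "g \<in> L2 M"
  shows "integrable M (\<lambda>s. cnj (f s) * g s)"
proof (rule Bochner_Integration.integrable_bound)
  show "integrable M (\<lambda>s. (cmod (f s))\<^sup>2 + (cmod (g s))\<^sup>2)"
    using assms by (auto simp: L2_def)
  have "f \<in> borel_measurable M" "g \<in> borel_measurable M"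
    using assms by (auto simp: L2_def)
  then show "(\<lambda>s. cnj (f s) * g s) \<in> borel_measurable M"
    by (intro borel_measurable_times borel_measurable_continuous_on[where f=cnj])
      (auto intro: continuous_intros)
  have "cmod (f s) * cmod (g s) \<le> (cmod (f s))\<^sup>2 + (cmod (g s))\<^sup>2" for s
    using sum_squares_bound[of "cmod (f s)" "cmod (g s)"]
      mult_nonneg_nonneg[OF norm_ge_zero[of "f s"] norm_ge_zero[of "g s"]] by linarith
  then show "AE s in M. norm (cnj (f s) * g s) \<le> norm ((cmod (f s))\<^sup>2 + (cmod (g s))\<^sup>2)"
    by (simp add: norm_mult)
qed

lemma L2_add:
  assumes "f \<in> L2 M" and "g \<in> L2 M"
  shows "(\<lambda>s. f s + g s) \<in> L2 M"
proof -
  have [measurable]: "f \<in> borel_measurable M" "g \<in> borel_measurable M"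
    using assms by (auto simp: L2_def)
  have "integrable M (\<lambda>s. (cmod (f s + g s))\<^sup>2)"
  proof (rule Bochner_Integration.integrable_bound)
    show "integrable M (\<lambda>s. 2 * (cmod (f s))\<^sup>2 + 2 * (cmod (g s))\<^sup>2)"
      using assms by (auto simp: L2_def)
    have "(cmod (f s + g s))\<^sup>2 \<le> 2 * (cmod (f s))\<^sup>2 + 2 * (cmod (g s))\<^sup>2" for s
    proof -
      have "(cmod (f s + g s))\<^sup>2 \<le> (cmod (f s) + cmod (g s))\<^sup>2"
        by (intro power_mono norm_triangle_ineq) auto
      also have "\<dots> \<le> 2 * (cmod (f s))\<^sup>2 + 2 * (cmod (g s))\<^sup>2"
        using sum_squares_bound[of "cmod (f s)" "cmod (g s)"] by (simp add: power2_sum)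
      finally show ?thesis .
    qed
    then show "AE s in M. norm ((cmod (f s + g s))\<^sup>2)
        \<le> norm (2 * (cmod (f s))\<^sup>2 + 2 * (cmod (g s))\<^sup>2)"
      by simp
  qed simp
  then show ?thesis by (simp add: L2_def)
qed

lemma L2_scale:
  assumes "f \<in> L2 M"
  shows "(\<lambda>s. a * f s) \<in> L2 M"
  using assms by (auto simp: L2_def norm_mult power_mult_distrib)

lemma L2_zero: "(\<lambda>s. 0) \<in> L2 M"
  by (simp add: L2_def)

lemma L2_sum:
  assumes "\<And>i. i \<in> I \<Longrightarrow> f i \<in> L2 M"
  shows "(\<lambda>s. \<Sum>i\<in>I. f i s) \<in> L2 M"
  \<comment> \<open>A sum over an infinite \<open>I\<close> is 0 by convention, so
    \<open>L2_zero\<close> covers that case as well.\<close>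
  using assms by (induction I rule: infinite_finite_induct) (simp_all add: L2_add L2_zero)

lemma l2_inner_commute: "l2_inner M g f = cnj (l2_inner M f g)"
proof -
  have "cnj (l2_inner M f g) = (LINT s|M. cnj (cnj (f s) * g s))"
    \<comment> \<open>Conjugation must stay outside the product in order to be pulled out of the
      integral.\<close>
    unfolding l2_inner_def by (simp del: complex_cnj_mult)
  then show ?thesis by (simp add: l2_inner_def mult.commute)
qed

lemma l2_inner_add_right:
  assumes "f \<in> L2 M" and "g \<in> L2 M" and "g' \<in> L2 M"
  shows "l2_inner M f (\<lambda>s. g s + g' s) = l2_inner M f g + l2_inner M f g'"
  using L2_prod_integrable[OF assms(1,2)] L2_prod_integrable[OF assms(1,3)]
  by (simp add: l2_inner_def distrib_left)

lemma l2_inner_scale_right: "l2_inner M f (\<lambda>s. a * g s) = a * l2_inner M f g"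
proof -
  have "l2_inner M f (\<lambda>s. a * g s) = (LINT s|M. a * (cnj (f s) * g s))"
    unfolding l2_inner_def by (simp add: mult.left_commute)
  then show ?thesis by (simp add: l2_inner_def)
qed

lemma l2_inner_sum_right:
  assumes "f \<in> L2 M" and "\<And>i. i \<in> I \<Longrightarrow> g i \<in> L2 M"
  shows "l2_inner M f (\<lambda>s. \<Sum>i\<in>I. g i s) = (\<Sum>i\<in>I. l2_inner M f (g i))"
  using L2_prod_integrable[OF assms(1) assms(2)]
  by (simp add: l2_inner_def sum_distrib_left)

lemma l2_inner_self: "l2_inner M f f = complex_of_real (power_of M f)"
proof -
  have "l2_inner M f f = (LINT s|M. complex_of_real ((cmod (f s))\<^sup>2))"
    unfolding l2_inner_def by (simp add: complex_norm_square mult.commute del: of_real_power)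
  then show ?thesis by (simp add: power_of_def del: of_real_power)
qed

lemma power_of_nonneg: "power_of M f \<ge> 0"
  by (simp add: power_of_def)

lemma power_of_pos:
  assumes "f \<in> L2 M" and "\<not> (AE s in M. f s = 0)"
  shows "power_of M f > 0"
proof -
  have "power_of M f \<noteq> 0"
    using assms integral_nonneg_eq_0_iff_AE[of M "\<lambda>s. (cmod (f s))\<^sup>2"]
    by (simp add: L2_def power_of_def)
  with power_of_nonneg[of M f] show ?thesis by simp
qed

lemma l2_inner_null_left:
  assumes "f \<in> L2 M" and "power_of M f = 0"
  shows "l2_inner M f g = 0"
proof -
  have "AE s in M. f s = 0"
    using assms power_of_pos by fastforce
  then have "AE s in M. cnj (f s) * g s = 0" by eventually_elim simp
  then show ?thesis
    unfolding l2_inner_def by (rule integral_eq_zero_AE)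
qed

section \<open>The Hermitian form \<open>T\<close> and its Cauchy-Schwarz inequality\<close>

definition leakage_form ::
    "'a measure \<Rightarrow> ('k::finite \<Rightarrow> 'a \<Rightarrow> complex) \<Rightarrow> real \<Rightarrow> ('a \<Rightarrow> complex) \<Rightarrow> ('a \<Rightarrow> complex) \<Rightarrow> complex"
  where "leakage_form M h c f g =
    (\<Sum>j\<in>UNIV. l2_inner M f (h j) * l2_inner M (h j) g) + complex_of_real c * l2_inner M f g"

lemma leakage_form_commute: "leakage_form M h c g f = cnj (leakage_form M h c f g)"
  unfolding leakage_form_def
  by (simp add: l2_inner_commute[of M g] l2_inner_commute[of M "h _" f] mult.commute)

lemma leakage_form_self:
  "leakage_form M h c f f =
    complex_of_real ((\<Sum>j\<in>UNIV. (cmod (l2_inner M (h j) f))\<^sup>2) + c * power_of M f)"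
  unfolding leakage_form_def
  by (simp add: l2_inner_self l2_inner_commute[of M f "h _"] complex_norm_square mult.commute
      del: of_real_power)

lemma leakage_form_linear_right:
  assumes "\<And>j. h j \<in> L2 M" and "f \<in> L2 M" and "g \<in> L2 M" and "g' \<in> L2 M"
  shows "leakage_form M h c f (\<lambda>s. g s + a * g' s) =
    leakage_form M h c f g + a * leakage_form M h c f g'"
  unfolding leakage_form_def
  by (simp add: l2_inner_add_right l2_inner_scale_right assms L2_scale algebra_simps
      sum.distrib sum_distrib_left)

text \<open>The form is nonnegative at the component of \<open>w\<close> orthogonal to
  \<open>d\<close> with respect to the form itself. The assumption \<open>pos\<close> permits
  dividing by the value at \<open>d\<close>; on functions the form is only semidefinite, as it
  vanishes at null functions.\<close>

lemma leakage_form_Cauchy_Schwarz: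
  assumes h: "\<And>j. h j \<in> L2 M" and d: "d \<in> L2 M" and w: "w \<in> L2 M" and c: "c \<ge> 0"
    and pos: "Re (leakage_form M h c d d) > 0"
  shows "(cmod (leakage_form M h c d w))\<^sup>2
    \<le> Re (leakage_form M h c d d) * Re (leakage_form M h c w w)"
proof -
  let ?T = "leakage_form M h c"
  define \<tau> where "\<tau> = Re (?T d d)"
  have Tdd: "?T d d = complex_of_real \<tau>"
    unfolding \<tau>_def leakage_form_self by simp
  have \<tau>: "\<tau> > 0" using pos by (simp add: \<tau>_def)
  \<comment> \<open>This coefficient subtracts from \<open>w\<close> its
    \<open>?T\<close>-projection onto \<open>d\<close>, so that \<open>?T d v = 0\<close>.\<close>
  define a where "a = - ?T d w / complex_of_real \<tau>"
  define v where "v = (\<lambda>s. w s + a * d s)"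
  have v: "v \<in> L2 M" unfolding v_def by (intro L2_add L2_scale w d)
  have "?T d v = 0"
    unfolding v_def leakage_form_linear_right[of h M, OF h d w d] using \<tau> by (simp add: Tdd a_def)
  then have "?T v d = 0" by (simp add: leakage_form_commute[of M h c v d])
  \<comment> \<open>Since \<open>?T v d = 0\<close>, the summand \<open>a * d s\<close> of the
    second \<open>v\<close> contributes nothing.\<close>
  then have "?T v v = ?T v w"
    using leakage_form_linear_right[of h M v w d c a] h v w d by (simp add: v_def)
  also have "\<dots> = cnj (?T w v)" by (rule leakage_form_commute)
  also have "?T w v = ?T w w + a * cnj (?T d w)"
    unfolding v_def using leakage_form_linear_right[of h M w w d c a] h w d
    by (simp add: leakage_form_commute[of M h c w d])
  also have "a * cnj (?T d w) = - complex_of_real ((cmod (?T d w))\<^sup>2 / \<tau>)"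
    unfolding a_def by (simp add: complex_norm_square flip: of_real_power)
  finally have "Re (?T v v) = Re (?T w w) - (cmod (?T d w))\<^sup>2 / \<tau>" by simp
  moreover have "Re (?T v v) \<ge> 0"
    unfolding leakage_form_self using c by (simp add: sum_nonneg power_of_nonneg)
  ultimately have "(cmod (?T d w))\<^sup>2 / \<tau> \<le> Re (?T w w)" by simp
  then show ?thesis using \<tau> by (simp add: \<tau>_def[symmetric] field_simps)
qed

section \<open>Invertibility of the regularized correlation matrix\<close>

lemma corr_matrix_nth: "corr_matrix M h $ k $ i = l2_inner M (h k) (h i)"
  by (simp add: corr_matrix_def l2_inner_def mult.commute)

text \<open>The correlation matrix is a Gram matrix, hence positive semidefinite, and adding the
  identity makes it definite. Concretely, pairing \<open>?A *v x = 0\<close> with \<open>x\<close>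
  gives the squared norm of \<open>x\<close> plus \<open>t\<close> times the power of the
  superposition \<open>f\<close>; both terms are nonnegative, so \<open>x = 0\<close>.\<close>

lemma regularized_corr_matrix_invertible:
  fixes h :: "'k::finite \<Rightarrow> 'a \<Rightarrow> complex"
  assumes h: "\<And>k. h k \<in> L2 M" and t: "t \<ge> 0"
  shows "invertible (mat 1 + t *\<^sub>R corr_matrix M h)" (is "invertible ?A")
proof -
  have "x = 0" if x: "?A *v x = 0" for x
  proof -
    define f where "f = (\<lambda>s. \<Sum>i\<in>UNIV. x $ i * h i s)"
    have f: "f \<in> L2 M" unfolding f_def by (intro L2_sum L2_scale h)
    have inner: "l2_inner M g f = (\<Sum>i\<in>UNIV. x $ i * l2_inner M g (h i))" if "g \<in> L2 M" for g
      unfolding f_def using that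
      by (simp add: l2_inner_sum_right L2_scale h l2_inner_scale_right)
    have row: "x $ k + complex_of_real t * l2_inner M (h k) f = 0" for k
    proof -
      have "(?A *v x) $ k = (\<Sum>i\<in>UNIV. (if k = i then x $ i else 0)
          + complex_of_real t * (x $ i * l2_inner M (h k) (h i)))"
        unfolding matrix_vector_mult_def
        by (auto simp: mat_def corr_matrix_nth scaleR_conv_of_real[where 'a=complex] algebra_simps intro!: sum.cong)
      also have "\<dots> = x $ k + complex_of_real t * l2_inner M (h k) f"
        by (simp add: sum.distrib inner h sum_distrib_left)
      finally show ?thesis using x by simp
    qed
    have "0 = (\<Sum>k\<in>UNIV. cnj (x $ k) * (x $ k + complex_of_real t * l2_inner M (h k) f))"
      by (simp add: row)
    also have "\<dots> = (\<Sum>k\<in>UNIV. complex_of_real ((cmod (x $ k))\<^sup>2))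
        + complex_of_real t * (\<Sum>k\<in>UNIV. cnj (x $ k) * l2_inner M (h k) f)"
      unfolding complex_norm_square sum_distrib_left sum.distrib[symmetric]
      by (intro sum.cong) (simp_all add: algebra_simps)
    \<comment> \<open>The quadratic form of the Gram matrix at \<open>x\<close> is the power of
      \<open>f\<close>, a nonnegative real.\<close>
    also have "(\<Sum>k\<in>UNIV. cnj (x $ k) * l2_inner M (h k) f) = cnj (l2_inner M f f)"
      by (simp add: inner[OF f] l2_inner_commute[of M "h _" f])
    also have "\<dots> = complex_of_real (power_of M f)" by (simp add: l2_inner_self)
    also have "(\<Sum>k\<in>UNIV. complex_of_real ((cmod (x $ k))\<^sup>2)) + complex_of_real t * \<dots>
        = complex_of_real ((\<Sum>k\<in>UNIV. (cmod (x $ k))\<^sup>2) + t * power_of M f)"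
      by (simp only: of_real_sum of_real_add of_real_mult)
    finally have eq: "(\<Sum>k\<in>UNIV. (cmod (x $ k))\<^sup>2) + t * power_of M f = 0"
      by (metis of_real_eq_0_iff)
    have "t * power_of M f \<ge> 0" by (rule mult_nonneg_nonneg[OF t power_of_nonneg])
    moreover have "(\<Sum>k\<in>UNIV. (cmod (x $ k))\<^sup>2) \<ge> 0" by (simp add: sum_nonneg)
    ultimately have "(\<Sum>k\<in>UNIV. (cmod (x $ k))\<^sup>2) = 0" using eq by linarith
    then show "x = 0" by (simp add: sum_nonneg_eq_0_iff vec_eq_iff)
  qed
  then show ?thesis
    by (simp add: invertible_left_inverse matrix_left_invertible_ker)
qed

text \<open>\<open>matrix_inv\<close> is defined by choice, so its characteristic equation holds
  once some inverse exists.\<close>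

lemma matrix_mult_matrix_inv:
  assumes "invertible A"
  shows "A ** matrix_inv A = mat 1"
  using someI_ex[OF assms[unfolded invertible_def]] by (simp add: matrix_inv_def)

section \<open>The MMSE direction as representer of the signal functional\<close>

lemma mmse_dir_expand:
  "mmse_dir M h P N k = (\<lambda>s. \<Sum>i\<in>UNIV.
     matrix_inv (mat 1 + (P / (real CARD('k) * N)) *\<^sub>R corr_matrix M h) $ i $ k * h i s)"
  for h :: "'k::finite \<Rightarrow> 'a \<Rightarrow> complex"
  by (simp add: mmse_dir_def vector_matrix_mult_def fun_eq_iff mult.commute)

lemma mmse_dir_L2:
  assumes "\<And>k. h k \<in> L2 M"
  shows "mmse_dir M h P N k \<in> L2 M"
  unfolding mmse_dir_expand by (intro L2_sum L2_scale assms)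

text \<open>Column \<open>k\<close> of \<open>A ** B = mat 1\<close> determines the inner products
  of all channels with \<open>d\<close>: each is \<open>c\<close> times the difference between an
  entry of the identity and one of \<open>B\<close>. In the form, the \<open>B\<close> terms cancel
  against \<open>c\<close> times the inner product of \<open>d\<close> and \<open>w\<close>, leaving
  only user \<open>k\<close>.\<close>

lemma leakage_form_mmse_dir:
  fixes h :: "'k::finite \<Rightarrow> 'a \<Rightarrow> complex"
  assumes h: "\<And>k. h k \<in> L2 M" and w: "w \<in> L2 M" and P: "P > 0" and N: "N > 0"
  defines "c \<equiv> real CARD('k) * N / P"
  shows "leakage_form M h c (mmse_dir M h P N k) w = complex_of_real c * l2_inner M (h k) w"
proof -
  define t where "t = P / (real CARD('k) * N)"
  have t: "t > 0" and tc: "t * c = 1" using P N by (simp_all add: t_def c_def)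
  define A where "A = mat 1 + t *\<^sub>R corr_matrix M h"
  define B where "B = matrix_inv A"
  define d where "d = mmse_dir M h P N k"
  have d_eq: "d = (\<lambda>s. \<Sum>i\<in>UNIV. B $ i $ k * h i s)"
    unfolding d_def mmse_dir_expand B_def A_def t_def ..
  have d: "d \<in> L2 M" unfolding d_def by (rule mmse_dir_L2[OF h])
  have inner: "l2_inner M g d = (\<Sum>i\<in>UNIV. B $ i $ k * l2_inner M g (h i))" if "g \<in> L2 M" for g
    unfolding d_eq using that
    by (simp add: l2_inner_sum_right L2_scale h l2_inner_scale_right)
  have "A ** B = mat 1"
    unfolding B_def A_def using t
    by (intro matrix_mult_matrix_inv regularized_corr_matrix_invertible h) simp
  then have AB: "(A ** B) $ j $ k = (if j = k then 1 else 0)" for j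
    by (simp add: mat_def)
  have hd: "l2_inner M (h j) d = complex_of_real c * ((if j = k then 1 else 0) - B $ j $ k)" for j
  proof -
    have "(A ** B) $ j $ k = (\<Sum>i\<in>UNIV. (if j = i then B $ i $ k else 0)
        + complex_of_real t * (B $ i $ k * l2_inner M (h j) (h i)))"
      unfolding matrix_matrix_mult_def A_def
      by (auto simp: mat_def corr_matrix_nth scaleR_conv_of_real[where 'a=complex] algebra_simps intro!: sum.cong)
    also have "\<dots> = B $ j $ k + complex_of_real t * l2_inner M (h j) d"
      by (simp add: sum.distrib inner h sum_distrib_left)
    finally have "complex_of_real t * l2_inner M (h j) d = (if j = k then 1 else 0) - B $ j $ k"
      using AB[of j] by (simp add: algebra_simps)
    \<comment> \<open>Multiplying by \<open>c\<close>, the reciprocal of \<open>t\<close>, isolates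
      the inner product.\<close>
    then have "complex_of_real (t * c) * l2_inner M (h j) d
        = complex_of_real c * ((if j = k then 1 else 0) - B $ j $ k)"
      by (metis (no_types) mult.assoc mult.commute of_real_mult)
    then show ?thesis by (simp add: tc)
  qed
  have dw: "l2_inner M d w = (\<Sum>j\<in>UNIV. cnj (B $ j $ k) * l2_inner M (h j) w)"
    by (simp add: l2_inner_commute[of M d w] inner[OF w] l2_inner_commute[of M w "h _"])
  have "leakage_form M h c d w = (\<Sum>j\<in>UNIV. complex_of_real c *
      (((if j = k then 1 else 0) - cnj (B $ j $ k)) * l2_inner M (h j) w
        + cnj (B $ j $ k) * l2_inner M (h j) w))"
    unfolding leakage_form_def dw sum_distrib_left sum.distrib[symmetric]
    by (auto simp: l2_inner_commute[of M d "h _"] hd algebra_simps intro!: sum.cong)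
  also have "\<dots> = (\<Sum>j\<in>UNIV. if j = k then complex_of_real c * l2_inner M (h j) w else 0)"
    by (intro sum.cong) (auto simp: algebra_simps)
  finally show ?thesis by (simp add: d_def)
qed

text \<open>A null direction would make the form vanish against every function, yet against
  \<open>h k\<close> it equals a positive multiple of the power of \<open>h k\<close>. Hence the
  rescaling to power \<open>P / K\<close> is meaningful.\<close>

lemma mmse_dir_power_pos:
  fixes h :: "'k::finite \<Rightarrow> 'a \<Rightarrow> complex"
  assumes h: "\<And>k. h k \<in> L2 M" and hk: "\<not> (AE s in M. h k s = 0)" and P: "P > 0" and N: "N > 0"
  shows "power_of M (mmse_dir M h P N k) > 0"
proof (rule ccontr)
  let ?d = "mmse_dir M h P N k" and ?c = "real CARD('k) * N / P"
  assume "\<not> power_of M ?d > 0"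
  then have "power_of M ?d = 0" using power_of_nonneg[of M ?d] by simp
  then have "l2_inner M ?d g = 0" for g
    by (rule l2_inner_null_left[OF mmse_dir_L2[OF h]])
  then have "leakage_form M h ?c ?d (h k) = 0" by (simp add: leakage_form_def)
  moreover have "leakage_form M h ?c ?d (h k) = complex_of_real (?c * power_of M (h k))"
    by (simp add: leakage_form_mmse_dir[OF h h P N] l2_inner_self)
  ultimately have "?c * power_of M (h k) = 0"
    by (metis of_real_eq_0_iff)
  then show False using P N power_of_pos[OF h hk] by simp
qed

section \<open>Normalization and optimality\<close>

lemma scale_to_power_power:
  assumes "p \<ge> 0" and "power_of M f > 0"
  shows "power_of M (scale_to_power M p f) = p"
  unfolding scale_to_power_def power_of_scale using assms by simp

text \<open>With signal \<open>S\<close> and total \<open>E + N\<close>, the SLNR is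
  \<open>S / (E + N - S)\<close>, increasing in \<open>S / (E + N)\<close>. After
  cross-multiplication the two inequalities differ by the product of both signals, which appears on
  each side.\<close>

lemma SLNR_le_if_ratio_le:
  fixes M :: "'a measure" and h :: "'k::finite \<Rightarrow> 'a \<Rightarrow> complex"
  defines "E \<equiv> \<lambda>w. \<Sum>j\<in>UNIV. (cmod (l2_inner M (h j) w))\<^sup>2"
  assumes N: "N > 0"
    and le: "(cmod (l2_inner M (h k) w))\<^sup>2 * (E v + N) \<le> (cmod (l2_inner M (h k) v))\<^sup>2 * (E w + N)"
  shows "SLNR M h N k w \<le> SLNR M h N k v"
proof -
  define I where "I = (\<lambda>w. \<Sum>j\<in>UNIV - {k}. (cmod (l2_inner M (h j) w))\<^sup>2)"
  have E: "E w = (cmod (l2_inner M (h k) w))\<^sup>2 + I w" for w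
    unfolding E_def I_def by (rule sum.remove) auto
  have I: "I w \<ge> 0" for w unfolding I_def by (simp add: sum_nonneg)
  have S: "SLNR M h N k w = (cmod (l2_inner M (h k) w))\<^sup>2 / (I w + N)" for w
    by (simp add: SLNR_def I_def l2_inner_def)
  have "I w + N > 0" "I v + N > 0" using I N by (simp_all add: add_nonneg_pos)
  then show ?thesis
    unfolding S using le unfolding E by (simp add: divide_simps algebra_simps)
qed

lemma w_MMSE_maximizes_SLNR:
  fixes h :: "'k::finite \<Rightarrow> 'a \<Rightarrow> complex"
  assumes h: "\<And>k. h k \<in> L2 M" and hk: "\<not> (AE s in M. h k s = 0)" and P: "P > 0" and N: "N > 0"
    and w: "w \<in> L2 M" and pw: "power_of M w = P / real CARD('k)"
  shows "SLNR M h N k w \<le> SLNR M h N k (w_MMSE M h P N k)"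
proof (rule SLNR_le_if_ratio_le[OF N])
  define c where "c = real CARD('k) * N / P"
  define p where "p = P / real CARD('k)"
  \<comment> \<open>The identity \<open>c * p = N\<close> is the reason for this \<open>c\<close>:
    at power \<open>p\<close> the term \<open>c * power_of M g\<close> of the form is exactly the
    noise.\<close>
  have c: "c > 0" and p: "p > 0" and cp: "c * p = N" using P N by (simp_all add: c_def p_def)
  let ?T = "leakage_form M h c"
  define d where "d = mmse_dir M h P N k"
  have d: "d \<in> L2 M" unfolding d_def by (rule mmse_dir_L2[OF h])
  have pd: "power_of M d > 0" unfolding d_def by (rule mmse_dir_power_pos[where h=h, OF h hk P N])
  have Td: "?T d g = complex_of_real c * l2_inner M (h k) g" if "g \<in> L2 M" for g
    unfolding d_def c_def using leakage_form_mmse_dir[OF h that P N] .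
  have Tself: "Re (?T g g) = (\<Sum>j\<in>UNIV. (cmod (l2_inner M (h j) g))\<^sup>2) + c * power_of M g" for g
    by (simp add: leakage_form_self)
  define \<tau> where "\<tau> = Re (?T d d)"
  have "\<tau> > 0"
    unfolding \<tau>_def Tself using c pd by (simp add: add_nonneg_pos sum_nonneg)
  have "(cmod (?T d w))\<^sup>2 \<le> \<tau> * Re (?T w w)"
    unfolding \<tau>_def using c \<open>\<tau> > 0\<close> unfolding \<tau>_def
    by (intro leakage_form_Cauchy_Schwarz h d w) auto
  then have CS: "c\<^sup>2 * (cmod (l2_inner M (h k) w))\<^sup>2 \<le> \<tau> * Re (?T w w)"
    by (simp add: Td[OF w] norm_mult power_mult_distrib)
  \<comment> \<open>Evaluating the representation at \<open>d\<close> itself yields the equality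
    case of Cauchy-Schwarz.\<close>
  have "complex_of_real \<tau> = ?T d d" unfolding \<tau>_def leakage_form_self by simp
  then have "cmod (complex_of_real \<tau>) = cmod (complex_of_real c * l2_inner M (h k) d)"
    by (simp only: Td[OF d])
  then have sd: "c\<^sup>2 * (cmod (l2_inner M (h k) d))\<^sup>2 = \<tau>\<^sup>2"
    by (metis norm_mult norm_of_real power2_abs power_mult_distrib)
  define r where "r = sqrt (p / power_of M d)"
  define v where "v = w_MMSE M h P N k"
  have v: "v = (\<lambda>s. complex_of_real r * d s)"
    unfolding v_def w_MMSE_def scale_to_power_def r_def p_def d_def ..
  have pv: "power_of M v = p"
    unfolding v_def w_MMSE_def p_def using P pd
    by (intro scale_to_power_power) (simp_all add: d_def)
  have inner_v: "(cmod (l2_inner M g v))\<^sup>2 = r\<^sup>2 * (cmod (l2_inner M g d))\<^sup>2" for g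
    unfolding v by (simp add: l2_inner_scale_right norm_mult power_mult_distrib)
  have Tv: "Re (?T v v) = r\<^sup>2 * \<tau>"
    unfolding \<tau>_def Tself inner_v unfolding v power_of_scale
    by (simp add: sum_distrib_left algebra_simps)
  \<comment> \<open>The factor \<open>c\<^sup>2\<close> lets \<open>CS\<close> apply to
    \<open>w\<close> and the equality \<open>sd\<close> to \<open>d\<close>; it is cancelled at the
    end.\<close>
  have "c\<^sup>2 * ((cmod (l2_inner M (h k) w))\<^sup>2 * Re (?T v v))
      = r\<^sup>2 * \<tau> * (c\<^sup>2 * (cmod (l2_inner M (h k) w))\<^sup>2)"
    by (simp add: Tv)
  also have "\<dots> \<le> r\<^sup>2 * \<tau> * (\<tau> * Re (?T w w))"
    using CS \<open>\<tau> > 0\<close> by (intro mult_left_mono) auto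
  also have "\<dots> = r\<^sup>2 * (c\<^sup>2 * (cmod (l2_inner M (h k) d))\<^sup>2) * Re (?T w w)"
    using sd by algebra
  also have "\<dots> = c\<^sup>2 * ((cmod (l2_inner M (h k) v))\<^sup>2 * Re (?T w w))"
    by (simp add: inner_v)
  finally have "(cmod (l2_inner M (h k) w))\<^sup>2 * Re (?T v v)
      \<le> (cmod (l2_inner M (h k) v))\<^sup>2 * Re (?T w w)"
    using c by simp
  then show "(cmod (l2_inner M (h k) w))\<^sup>2 * ((\<Sum>j\<in>UNIV. (cmod (l2_inner M (h j) v))\<^sup>2) + N)
      \<le> (cmod (l2_inner M (h k) v))\<^sup>2 * ((\<Sum>j\<in>UNIV. (cmod (l2_inner M (h j) w))\<^sup>2) + N)"
    unfolding Tself pv pw p_def[symmetric] cp .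
qed

theorem theorem2:
  fixes S :: "(real ^ 3) set"
    and ds :: "(real ^ 3) measure"
    and h :: "'k::finite \<Rightarrow> real ^ 3 \<Rightarrow> complex"
    and P \<sigma> :: real
  assumes "bounded S"
    and "sets ds = sets (restrict_space borel S)"
    and "\<And>k. h k \<in> L2 ds"
    and "\<And>k. \<not> (AE s in ds. h k s = 0)"
    and "P > 0"
    and "\<sigma>\<^sup>2 > 0"
  shows "\<forall>k. is_arg_max (SLNR ds h (\<sigma>\<^sup>2) k)
               (\<lambda>w. w \<in> L2 ds \<and> (LINT s|ds. (cmod (w s))\<^sup>2) = P / real CARD('k))
               (w_MMSE ds h P (\<sigma>\<^sup>2) k)"
proof
  fix k
  let ?v = "w_MMSE ds h P (\<sigma>\<^sup>2) k"
  have "?v \<in> L2 ds"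
    unfolding w_MMSE_def scale_to_power_def by (intro L2_scale mmse_dir_L2 assms(3))
  moreover have "power_of ds ?v = P / real CARD('k)"
    unfolding w_MMSE_def using assms(5)
    by (intro scale_to_power_power mmse_dir_power_pos[where h=h, OF assms(3-6)]) simp
  moreover have "SLNR ds h (\<sigma>\<^sup>2) k w \<le> SLNR ds h (\<sigma>\<^sup>2) k ?v"
    if "w \<in> L2 ds" "power_of ds w = P / real CARD('k)" for w
    by (rule w_MMSE_maximizes_SLNR[where h=h, OF assms(3-6) that])
  ultimately show "is_arg_max (SLNR ds h (\<sigma>\<^sup>2) k)
      (\<lambda>w. w \<in> L2 ds \<and> (LINT s|ds. (cmod (w s))\<^sup>2) = P / real CARD('k)) ?v"
    \<comment> \<open>\<open>is_arg_max\<close> demands feasibility and that no feasible point has a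
      strictly larger value; in a linear order the latter is the inequality just shown.\<close>
    by (auto simp: is_arg_max_def power_of_def not_less)
qed

end
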